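(* Let $G$ be a finite graph and let $H$ be an elementary subdivision of $G$. Then $$\left\lceil \frac{2B'(G)+\delta}{3}\right\rceil\le B'(H)\le B'(G)+1,$$ where $\delta=1$ if $B'(H)$ is odd and $\delta=0$ if $B'(H)$ is even. Moreover, both bounds are sharp: each inequality holds with equality for some graph $G$ and some elementary subdivision $H$ of $G$.
   Context: Subdividing an edge $uv$ means replacing it by a path $u,w,v$ through a new vertex $w$; an elementary subdivision of $G$ is a graph obtained from $G$ by subdividing one edge. An edge-numbering of a graph $G$ is an assignment $f$ of distinct integers to the edges; $B'(f)$ is the maximum of $|f(e)-f(e')|$ over pairs of distinct incident edges $e,e'$. The edge-bandwidth $B'(G)$ is the minimum of $B'(f)$ over all edge-numberings $f$ of $G$. *)

theory Defs
  imports Complex_Main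
begin

definition finite_graph :: "'a set \<Rightarrow> 'a set set \<Rightarrow> bool" where
  "finite_graph V E \<longleftrightarrow> finite V \<and> E \<subseteq> {e. e \<subseteq> V \<and> card e = 2}"

definition elementary_subdivision ::
  "'a set \<Rightarrow> 'a set set \<Rightarrow> 'a set \<Rightarrow> 'a set set \<Rightarrow> bool" where
  "elementary_subdivision V E V' E' \<longleftrightarrow>
     (\<exists>u v w. {u, v} \<in> E \<and> w \<notin> V \<and>
        V' = insert w V \<and> E' = (E - {{u, v}}) \<union> {{u, w}, {w, v}})"

definition edge_numbering :: "'a set set \<Rightarrow> ('a set \<Rightarrow> int) \<Rightarrow> bool" where
  "edge_numbering E f \<longleftrightarrow> inj_on f E"

text \<open>The inserted \<open>0\<close> fixes the value for graphs without two distinct incident edges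
  and is otherwise irrelevant, as all the differences are nonnegative.\<close>

definition numbering_bandwidth :: "'a set set \<Rightarrow> ('a set \<Rightarrow> int) \<Rightarrow> nat" where
  "numbering_bandwidth E f =
     Max (insert 0 {nat \<bar>f e - f e'\<bar> | e e'. e \<in> E \<and> e' \<in> E \<and> e \<noteq> e' \<and> e \<inter> e' \<noteq> {}})"

definition edge_bandwidth :: "'a set set \<Rightarrow> nat" where
  "edge_bandwidth E = (LEAST k. \<exists>f. edge_numbering E f \<and> numbering_bandwidth E f = k)"

end

theory Submission
  imports Defs
begin

text \<open>Upper bound: give the two halves of the subdivided edge the numbers \<open>f e\<close> and \<open>f e + 1\<close>
  and shift all larger numbers up by one. Lower bound: if the two halves carry the numbers
  \<open>a < c\<close> in an optimal numbering of the subdivision, give the restored edge the midpoint \<open>m\<close>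
  of \<open>a\<close> and \<open>c\<close>, and make room for it by moving the numbers in \<open>{a<..m}\<close> and those above
  \<open>c\<close> down by one. A difference can grow only between numbers lying strictly between \<open>a\<close> and
  \<open>c\<close>, where it is smaller than \<open>c - a\<close> to begin with, so only the differences with the restored
  edge exceed the old bandwidth, by at most \<open>(c - a) div 2\<close>. Both bounds are attained by
  subdividing a single edge.\<close>

section \<open>Numberings and their bandwidth as pointwise bounds\<close>

lemma numbering_bandwidth_le_iff:
  assumes "finite E"
  shows "numbering_bandwidth E f \<le> k \<longleftrightarrow>
    (\<forall>e\<in>E. \<forall>e'\<in>E. e \<noteq> e' \<longrightarrow> e \<inter> e' \<noteq> {} \<longrightarrow> \<bar>f e - f e'\<bar> \<le> int k)"
proof -
  let ?D = "{nat \<bar>f e - f e'\<bar> | e e'. e \<in> E \<and> e' \<in> E \<and> e \<noteq> e' \<and> e \<inter> e' \<noteq> {}}"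
  \<comment> \<open>As an image of part of \<open>E \<times> E\<close> the set is finite, so
    \<open>Max\<close> ranges over a finite set, and the inserted 0 lies below every
    \<open>k\<close>.\<close>
  have "?D \<subseteq> (\<lambda>(e, e'). nat \<bar>f e - f e'\<bar>) ` (E \<times> E)"
    by auto
  then have "finite ?D"
    using assms by (meson finite_SigmaI finite_imageI finite_subset)
  then have "numbering_bandwidth E f \<le> k \<longleftrightarrow> (\<forall>d\<in>?D. d \<le> k)"
    unfolding numbering_bandwidth_def by simp
  also have "\<dots> \<longleftrightarrow>
    (\<forall>e\<in>E. \<forall>e'\<in>E. e \<noteq> e' \<longrightarrow> e \<inter> e' \<noteq> {} \<longrightarrow> nat \<bar>f e - f e'\<bar> \<le> k)"
    by blast
  finally show ?thesis
    by (simp add: nat_le_iff)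
qed

lemma edge_bandwidth_leI:
  assumes "finite E" and "inj_on f E"
    and "\<And>e e'. e \<in> E \<Longrightarrow> e' \<in> E \<Longrightarrow> e \<noteq> e' \<Longrightarrow> e \<inter> e' \<noteq> {} \<Longrightarrow> \<bar>f e - f e'\<bar> \<le> int k"
  shows "edge_bandwidth E \<le> k"
proof -
  have "edge_bandwidth E \<le> numbering_bandwidth E f"
    unfolding edge_bandwidth_def edge_numbering_def using assms(2) by (blast intro: Least_le)
  also have "\<dots> \<le> k"
    using assms(3) by (simp add: numbering_bandwidth_le_iff[OF assms(1)])
  finally show ?thesis .
qed

text \<open>A finite edge set injects into the naturals, so \<open>LEAST\<close> minimises over a
  nonempty set and an optimal numbering exists.\<close>

lemma edge_bandwidth_attained:
  assumes "finite E"
  obtains f where "inj_on f E"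
    and "\<And>e e'. e \<in> E \<Longrightarrow> e' \<in> E \<Longrightarrow> e \<noteq> e' \<Longrightarrow> e \<inter> e' \<noteq> {} \<Longrightarrow>
      \<bar>f e - f e'\<bar> \<le> int (edge_bandwidth E)"
proof -
  obtain g :: "'a set \<Rightarrow> nat" where "inj_on g E"
    using finite_imp_inj_to_nat_seg[OF assms] by blast
  then have "edge_numbering E (\<lambda>e. int (g e))"
    by (simp add: edge_numbering_def inj_on_def)
  then have "\<exists>k f. edge_numbering E f \<and> numbering_bandwidth E f = k"
    by blast
  then have "\<exists>f. edge_numbering E f \<and> numbering_bandwidth E f = edge_bandwidth E"
    unfolding edge_bandwidth_def by (rule LeastI_ex)
  then obtain f where f: "inj_on f E" "numbering_bandwidth E f \<le> edge_bandwidth E"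
    by (auto simp: edge_numbering_def)
  show ?thesis
    using that[OF f(1)] f(2) by (simp add: numbering_bandwidth_le_iff[OF assms])
qed

lemma finite_graph_finite_edges: "finite_graph V E \<Longrightarrow> finite E"
  unfolding finite_graph_def by (auto intro: finite_subset[of E "Pow V"])

lemma inj_on_disjoint_Un:
  "inj_on f A \<Longrightarrow> inj_on f B \<Longrightarrow> f ` A \<inter> f ` B = {} \<Longrightarrow> inj_on f (A \<union> B)"
  unfolding inj_on_Un by blast

section \<open>Upper bound for the subdivision\<close>

lemma edge_bandwidth_subdivision_le:
  assumes "finite E" and uv: "{u, v} \<in> E" "u \<noteq> v" and w: "w \<notin> \<Union>E"
  shows "edge_bandwidth (E - {{u, v}} \<union> {{u, w}, {w, v}}) \<le> edge_bandwidth E + 1"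
proof -
  obtain f where inj: "inj_on f E"
    and f: "\<And>e e'. e \<in> E \<Longrightarrow> e' \<in> E \<Longrightarrow> e \<noteq> e' \<Longrightarrow> e \<inter> e' \<noteq> {} \<Longrightarrow>
      \<bar>f e - f e'\<bar> \<le> int (edge_bandwidth E)"
    using edge_bandwidth_attained[OF assms(1)] by blast
  define p where "p = f {u, v}"
  define g where "g e = (if e = {u, w} then p else if e = {w, v} then p + 1
    else if f e > p then f e + 1 else f e)" for e
  have old: "w \<notin> e" "e \<noteq> {u, w}" "e \<noteq> {w, v}" "f e \<noteq> p"
    "g e = (if f e > p then f e + 1 else f e)"
    if "e \<in> E - {{u, v}}" for e
    using that w uv inj by (auto simp: p_def g_def inj_on_def)
  have "{w, v} \<noteq> {u, w}"
    using uv w by (auto simp: doubleton_eq_iff)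
  then have guw: "g {u, w} = p" and gwv: "g {w, v} = p + 1"
    by (auto simp: g_def)
  have near: "\<bar>f e - p\<bar> \<le> int (edge_bandwidth E)"
    if "e \<in> E - {{u, v}}" "u \<in> e \<or> v \<in> e" for e
    using f[of e "{u, v}"] that uv by (auto simp: p_def)
  \<comment> \<open>No old edge contains \<open>w\<close>, so an old edge touching a half touches it
    in \<open>u\<close> or \<open>v\<close>. It was thus incident to \<open>{u, v}\<close>, and
    \<open>near\<close> applies.\<close>
  have meet: "u \<in> e \<or> v \<in> e" if "e \<in> E - {{u, v}}" "e' = {u, w} \<or> e' = {w, v}"
    "e \<inter> e' \<noteq> {}" for e e'
    using that old(1)[OF that(1)] by auto
  show ?thesis
  proof (rule edge_bandwidth_leI[where f = g])
    show "finite (E - {{u, v}} \<union> {{u, w}, {w, v}})"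
      using assms(1) by simp
    have old_ne: "g e \<noteq> g e'" if "e \<in> E - {{u, v}}" "e' \<in> E - {{u, v}}" "e \<noteq> e'" for e e'
    proof -
      have "f e \<noteq> f e'"
        using that inj_onD[OF inj, of e e'] by blast
      then show ?thesis
        using old(5)[OF that(1)] old(5)[OF that(2)] by simp
    qed
    \<comment> \<open>Old numbers below \<open>p\<close> stay and those above \<open>p\<close>
      become at least \<open>p + 2\<close>, which leaves both \<open>p\<close> and
      \<open>p + 1\<close> to the halves.\<close>
    have new_ne: "g e \<noteq> p" "g e \<noteq> p + 1" if "e \<in> E - {{u, v}}" for e
      using old(4,5)[OF that] by (auto split: if_splits)
    have "inj_on g (E - {{u, v}})"
      using old_ne by (meson inj_onI)
    moreover have "inj_on g {{u, w}, {w, v}}"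
      by (auto simp: guw gwv)
    moreover have "g ` (E - {{u, v}}) \<inter> g ` {{u, w}, {w, v}} = {}"
      using new_ne unfolding image_insert image_empty guw gwv by blast
    ultimately show "inj_on g (E - {{u, v}} \<union> {{u, w}, {w, v}})"
      by (rule inj_on_disjoint_Un)
    fix e e'
    assume e: "e \<in> E - {{u, v}} \<union> {{u, w}, {w, v}}" "e' \<in> E - {{u, v}} \<union> {{u, w}, {w, v}}"
      and ne: "e \<noteq> e'" and inc: "e \<inter> e' \<noteq> {}"
    consider "e \<in> E - {{u, v}}" "e' \<in> E - {{u, v}}"
      | "e \<in> E - {{u, v}}" "e' = {u, w} \<or> e' = {w, v}"
      | "e' \<in> E - {{u, v}}" "e = {u, w} \<or> e = {w, v}"
      | "e = {u, w} \<or> e = {w, v}" "e' = {u, w} \<or> e' = {w, v}"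
      using e unfolding Un_iff insert_iff empty_iff by metis
    then show "\<bar>g e - g e'\<bar> \<le> int (edge_bandwidth E + 1)"
    proof cases
      case 1
      then have "\<bar>f e - f e'\<bar> \<le> int (edge_bandwidth E)"
        using f[of e e'] ne inc by simp
      then show ?thesis
        using old(5)[OF 1(1)] old(5)[OF 1(2)] by auto
    next
      case 2
      then have "g e' = p \<or> g e' = p + 1"
        using guw gwv by metis
      \<comment> \<open>Above \<open>p\<close> only the distance to \<open>p\<close> grows by one,
        since the shift cancels against \<open>p + 1\<close>; below \<open>p\<close> only the
        distance to \<open>p + 1\<close> grows.\<close>
      then show ?thesis
        using near[OF 2(1) meet[OF 2 inc]] old(4,5)[OF 2(1)] by auto
    next
      case 3
      then have "g e = p \<or> g e = p + 1"
        using guw gwv by metis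
      then show ?thesis
        using near[OF 3(1) meet[OF 3]] inc old(4,5)[OF 3(1)] by (auto simp: Int_commute)
    next
      case 4
      then have "g e = p \<or> g e = p + 1" "g e' = p \<or> g e' = p + 1"
        using guw gwv by metis+
      then show ?thesis
        by auto
    qed
  qed
qed

section \<open>Lower bound for the subdivision\<close>

text \<open>An edge at \<open>u\<close> or \<open>v\<close> has a number within \<open>b\<close> of
  \<open>a\<close> or of \<open>c\<close>, and the midpoint is at most half of
  \<open>c - a \<le> b\<close> away from either, up to rounding. The shifts absorb the
  rounding.\<close>

lemma edge_bandwidth_le_of_subdivision_numbering:
  fixes b :: nat
  assumes "finite E" and uv: "{u, v} \<in> E" "u \<noteq> v" and w: "w \<notin> \<Union>E"
    and inj: "inj_on g (E - {{u, v}} \<union> {{u, w}, {w, v}})"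
    and g: "\<And>e e'. e \<in> E - {{u, v}} \<union> {{u, w}, {w, v}} \<Longrightarrow>
      e' \<in> E - {{u, v}} \<union> {{u, w}, {w, v}} \<Longrightarrow> e \<noteq> e' \<Longrightarrow> e \<inter> e' \<noteq> {} \<Longrightarrow>
      \<bar>g e - g e'\<bar> \<le> int b"
    and less: "g {u, w} < g {w, v}"
  shows "edge_bandwidth E \<le> b + b div 2"
proof -
  define a c where "a = g {u, w}" and "c = g {w, v}"
  define m where "m = a + (c - a) div 2"
  define f where "f e = (if e = {u, v} then m
    else if a < g e \<and> g e \<le> m \<or> c < g e then g e - 1 else g e)" for e
  \<comment> \<open>The halves share \<open>w\<close>, so \<open>c - a\<close> is itself a bounded
    difference; \<open>less\<close> excludes that they coincide.\<close>
  have ac: "a < c" "c - a \<le> int b"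
    using less g[of "{w, v}" "{u, w}"]
    by (cases "{w, v} = {u, w}"; simp add: a_def c_def; fail)+
  \<comment> \<open>\<open>m\<close> rounds down: for odd \<open>c - a\<close> it is one closer to
    \<open>a\<close> than to \<open>c\<close>.\<close>
  have m: "a \<le> m" "m < c" "m - a \<le> int (b div 2)" "c - m \<le> m - a + 1"
    using ac by (auto simp: m_def)
  have old: "w \<notin> e" "e \<noteq> {u, w}" "e \<noteq> {w, v}" "g e \<noteq> a" "g e \<noteq> c"
    "f e = (if a < g e \<and> g e \<le> m \<or> c < g e then g e - 1 else g e)"
    if "e \<in> E - {{u, v}}" for e
  proof -
    show *: "w \<notin> e" "e \<noteq> {u, w}" "e \<noteq> {w, v}"
      using that w by auto
    show "g e \<noteq> a" "g e \<noteq> c"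
      using * that inj_onD[OF inj, of e "{u, w}"] inj_onD[OF inj, of e "{w, v}"]
      by (auto simp: a_def c_def)
  qed (use that in \<open>auto simp: f_def\<close>)
  have fuv: "f {u, v} = m"
    by (simp add: f_def)
  have near: "\<bar>f e - m\<bar> \<le> int (b + b div 2)"
    if e: "e \<in> E - {{u, v}}" and inc: "e \<inter> {u, v} \<noteq> {}" for e
  proof -
    have "\<bar>g e - a\<bar> \<le> int b \<or> \<bar>g e - c\<bar> \<le> int b"
      using g[of e "{u, w}"] g[of e "{w, v}"] old(2,3)[OF e] e inc by (auto simp: a_def c_def)
    \<comment> \<open>The critical case is \<open>g e > c\<close>: the distance from
      \<open>c\<close> to \<open>m\<close> may be \<open>m - a + 1\<close>, and lowering the numbers
      above \<open>c\<close> by one pays for the extra 1.\<close>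
    then show ?thesis
      using old(4-6)[OF e] m ac by (auto split: if_splits)
  qed
  show ?thesis
  proof (rule edge_bandwidth_leI[OF assms(1), where f = f])
    have old_ne: "f e \<noteq> f e'" if "e \<in> E - {{u, v}}" "e' \<in> E - {{u, v}}" "e \<noteq> e'" for e e'
    proof -
      have "g e \<noteq> g e'"
        using that inj_onD[OF inj, of e e'] by blast
      then show ?thesis
        using old(4-6)[OF that(1)] old(4-6)[OF that(2)] m by (auto split: if_splits)
    qed
    have new_ne: "f e \<noteq> f {u, v}" if "e \<in> E - {{u, v}}" for e
      using old(4-6)[OF that] m fuv by (auto split: if_splits)
    show "inj_on f E"
      by (rule inj_onI) (metis old_ne new_ne Diff_iff singletonD)
    fix e e'
    assume e: "e \<in> E" "e' \<in> E" and ne: "e \<noteq> e'" and inc: "e \<inter> e' \<noteq> {}"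
    consider "e = {u, v}" | "e' = {u, v}" | "e \<in> E - {{u, v}}" "e' \<in> E - {{u, v}}"
      using e by blast
    then show "\<bar>f e - f e'\<bar> \<le> int (b + b div 2)"
    proof cases
      case 1
      then show ?thesis
        using near[of e'] e ne inc fuv by (auto simp: Int_commute abs_minus_commute)
    next
      case 2
      then show ?thesis
        using near[of e] e ne inc fuv by auto
    next
      case 3
      then have "\<bar>g e - g e'\<bar> \<le> int b"
        using g[of e e'] ne inc by simp
      \<comment> \<open>A gap grows only if the smaller number lies in \<open>{a<..m}\<close> and
        the larger in \<open>{m<..<c}\<close>. It is then at most \<open>c - a - 2\<close>, and
        growing by one keeps it below \<open>b\<close>.\<close>
      then have "\<bar>f e - f e'\<bar> \<le> int b"
        using old(4-6)[OF 3(1)] old(4-6)[OF 3(2)] m(1,2) ac by (auto split: if_splits)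
      then show ?thesis
        by simp
    qed
  qed
qed

lemma edge_bandwidth_le_subdivision:
  assumes "finite E" and uv: "{u, v} \<in> E" "u \<noteq> v" and w: "w \<notin> \<Union>E"
    and E': "E' = E - {{u, v}} \<union> {{u, w}, {w, v}}"
  shows "edge_bandwidth E \<le> edge_bandwidth E' + edge_bandwidth E' div 2"
proof -
  have "finite E'"
    using assms(1) E' by simp
  then obtain g where g: "inj_on g E'"
    "\<And>e e'. e \<in> E' \<Longrightarrow> e' \<in> E' \<Longrightarrow> e \<noteq> e' \<Longrightarrow> e \<inter> e' \<noteq> {} \<Longrightarrow>
      \<bar>g e - g e'\<bar> \<le> int (edge_bandwidth E')"
    using edge_bandwidth_attained by blast
  \<comment> \<open>Exchanging \<open>u\<close> and \<open>v\<close> gives the same subdivision, so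
    either order of the two numbers on the halves can be treated as increasing.\<close>
  have E'_sym: "E' = E - {{v, u}} \<union> {{v, w}, {w, u}}"
    using E' by (simp add: insert_commute)
  have "u \<noteq> w" "v \<noteq> w"
    using uv w by auto
  then have "{u, w} \<noteq> {w, v}"
    using uv by (auto simp: doubleton_eq_iff)
  then have "g {u, w} \<noteq> g {w, v}"
    using g(1) E' by (auto simp: inj_on_def)
  then consider "g {u, w} < g {w, v}" | "g {v, w} < g {w, u}"
    by (metis insert_commute linorder_neqE)
  then show ?thesis
  proof cases
    case 1
    then show ?thesis
      using edge_bandwidth_le_of_subdivision_numbering[OF assms(1) uv w] g unfolding E' by blast
  next
    case 2
    have "{v, u} \<in> E" "v \<noteq> u"
      using uv by (simp_all add: insert_commute)
    from edge_bandwidth_le_of_subdivision_numbering[OF assms(1) this w, of g "edge_bandwidth E'"]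
    show ?thesis
      using 2 g unfolding E'_sym by blast
  qed
qed

section \<open>Sharpness and conclusion\<close>

lemma edge_bandwidth_single_edge: "edge_bandwidth {e} = 0"
  using edge_bandwidth_leI[of "{e}" "\<lambda>_. 0" 0] by simp

text \<open>Distinct integers on two incident edges differ by at least 1.\<close>

lemma edge_bandwidth_pos:
  assumes "finite E" "e \<in> E" "e' \<in> E" "e \<noteq> e'" "e \<inter> e' \<noteq> {}"
  shows "0 < edge_bandwidth E"
proof -
  obtain f where "inj_on f E" "\<bar>f e - f e'\<bar> \<le> int (edge_bandwidth E)"
    using edge_bandwidth_attained[OF assms(1)] assms(2-5) by metis
  then show ?thesis
    using assms(2-4) by (cases "edge_bandwidth E = 0") (auto simp: inj_on_def)
qed

text \<open>One example serves both equalities: the bandwidth rises from 0 to 1, and the lower bound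
  there is 1/3 rounded up.\<close>

lemma subdivided_single_edge:
  fixes V V' :: "nat set"
  defines "V \<equiv> {0, 1}" and "E \<equiv> {{0, 1 :: nat}}"
    and "V' \<equiv> {0, 1, 2}" and "E' \<equiv> {{0, 2}, {2, 1 :: nat}}"
  shows "finite_graph V E" "elementary_subdivision V E V' E'"
    "edge_bandwidth E = 0" "edge_bandwidth E' = 1"
proof -
  show "finite_graph V E"
    by (simp add: finite_graph_def V_def E_def)
  show "elementary_subdivision V E V' E'"
    unfolding elementary_subdivision_def
    by (intro exI[of _ 0] exI[of _ 1] exI[of _ 2]) (auto simp: V_def E_def V'_def E'_def)
  show E: "edge_bandwidth E = 0"
    by (simp add: E_def edge_bandwidth_single_edge)
  have "edge_bandwidth E' \<le> 1"
    using edge_bandwidth_subdivision_le[of E 0 1 2] E by (simp add: E_def E'_def)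
  moreover have "0 < edge_bandwidth E'"
    by (rule edge_bandwidth_pos[of _ "{0, 2}" "{2, 1}"]) (auto simp: E'_def doubleton_eq_iff)
  ultimately show "edge_bandwidth E' = 1"
    by simp
qed

theorem theorem11:
  "(\<forall>(V :: 'a set) E V' E'.
      finite_graph V E \<longrightarrow> elementary_subdivision V E V' E' \<longrightarrow>
        \<lceil>(2 * real (edge_bandwidth E) + (if odd (edge_bandwidth E') then 1 else 0)) / 3\<rceil>
          \<le> int (edge_bandwidth E') \<and>
        edge_bandwidth E' \<le> edge_bandwidth E + 1) \<and>
   (\<exists>(V :: nat set) E V' E'.
      finite_graph V E \<and> elementary_subdivision V E V' E' \<and>
        \<lceil>(2 * real (edge_bandwidth E) + (if odd (edge_bandwidth E') then 1 else 0)) / 3\<rceil>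
          = int (edge_bandwidth E')) \<and>
   (\<exists>(V :: nat set) E V' E'.
      finite_graph V E \<and> elementary_subdivision V E V' E' \<and>
        edge_bandwidth E' = edge_bandwidth E + 1)"
proof (intro conjI allI impI)
  fix V :: "'a set" and E V' E'
  assume G: "finite_graph V E" and "elementary_subdivision V E V' E'"
  then obtain u v w where uv: "{u, v} \<in> E" and "w \<notin> V"
    and E': "E' = E - {{u, v}} \<union> {{u, w}, {w, v}}"
    unfolding elementary_subdivision_def by blast
  then have w: "w \<notin> \<Union>E" and "card {u, v} = 2"
    using G by (auto simp: finite_graph_def)
  then have "u \<noteq> v"
    by auto
  note fin = finite_graph_finite_edges[OF G]
  have "edge_bandwidth E \<le> edge_bandwidth E' + edge_bandwidth E' div 2"
    using edge_bandwidth_le_subdivision[OF fin uv \<open>u \<noteq> v\<close> w E'] .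
  \<comment> \<open>For any natural \<open>b\<close>, \<open>2 * (b + b div 2)\<close> is
    \<open>3 * b\<close> minus the parity of \<open>b\<close>; the parity term is exactly what the
    integer halving loses.\<close>
  then have "2 * edge_bandwidth E + (if odd (edge_bandwidth E') then 1 else 0)
      \<le> 3 * edge_bandwidth E'"
    by (auto elim!: oddE evenE)
  then have "2 * real (edge_bandwidth E) + (if odd (edge_bandwidth E') then 1 else 0)
      \<le> 3 * real (edge_bandwidth E')"
    by (auto split: if_splits)
  then show "\<lceil>(2 * real (edge_bandwidth E) + (if odd (edge_bandwidth E') then 1 else 0)) / 3\<rceil>
      \<le> int (edge_bandwidth E')"
    by (simp add: ceiling_le_iff)
  show "edge_bandwidth E' \<le> edge_bandwidth E + 1"
    using edge_bandwidth_subdivision_le[OF fin uv \<open>u \<noteq> v\<close> w] E' by simp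
next
  have "\<lceil>(2 * real 0 + (if odd (1 :: nat) then 1 else 0)) / 3\<rceil> = int 1"
    by (simp add: ceiling_eq_iff)
  then show "\<exists>(V :: nat set) E V' E'.
      finite_graph V E \<and> elementary_subdivision V E V' E' \<and>
        \<lceil>(2 * real (edge_bandwidth E) + (if odd (edge_bandwidth E') then 1 else 0)) / 3\<rceil>
          = int (edge_bandwidth E')"
    using subdivided_single_edge by metis
next
  show "\<exists>(V :: nat set) E V' E'.
      finite_graph V E \<and> elementary_subdivision V E V' E' \<and>
        edge_bandwidth E' = edge_bandwidth E + 1"
    using subdivided_single_edge by (metis add_0)
qed

end
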